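(* Let $\mathcal{T}$ be a triangulated category, and let $(f,g,h)$ be a map of triangles from $X\xrightarrow{u}Y\xrightarrow{v}Z\xrightarrow{w}\Sigma X$ to $X'\xrightarrow{u'}Y'\xrightarrow{v'}Z'\xrightarrow{w'}\Sigma X'$. Then $(f,g,h)$ is Verdier good if and only if it extends to a $4\times4$ diagram, i.e. there are exact triangles $$X\xrightarrow{f}X'\xrightarrow{f'}X''\xrightarrow{f''}\Sigma X,\quad Y\xrightarrow{g}Y'\xrightarrow{g'}Y''\xrightarrow{g''}\Sigma Y,\quad Z\xrightarrow{h}Z'\xrightarrow{h'}Z''\xrightarrow{h''}\Sigma Z,\quad X''\xrightarrow{u''}Y''\xrightarrow{v''}Z''\xrightarrow{w''}\Sigma X''$$ satisfying $g'u'=u''f'$, $h'v'=v''g'$, $(\Sigma f')w'=w''h'$, $g''u''=(\Sigma u)f''$, $h''v''=(\Sigma v)g''$, $(\Sigma f'')w''=-(\Sigma w)h''$ (that is, $(f,g,h)$ is middling good), and there is an object $A$ together with maps $\tilde v\colon Y'\to A$, $\tilde w\colon A\to\Sigma X$, $\alpha_1\colon Z\to A$, $\beta_1\colon A\to Y''$, $\alpha_2\colon X''\to A$, $\beta_2\colon A\to Z'$ satisfying the following three families of conditions. (First hexagon) The sequences $$X\xrightarrow{gu=u'f}Y'\xrightarrow{\tilde v}A\xrightarrow{\tilde w}\Sigma X,\qquad Z\xrightarrow{\alpha_1}A\xrightarrow{\beta_1}Y''\xrightarrow{(\Sigma v)g''}\Sigma Z,\qquad X''\xrightarrow{\alpha_2}A\xrightarrow{\beta_2}Z'\xrightarrow{(\Sigma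 f')w'}\Sigma X''$$ are exact triangles; $\tilde w\alpha_1=w$, $\beta_2\tilde v=v'$, $\beta_1\alpha_2=u''$; and the three diameters compose to the corresponding vertical maps: $\beta_2\alpha_1=h$, $\beta_1\tilde v=g'$, $\tilde w\alpha_2=f''$. (Second hexagon) $w'\beta_2=(\Sigma f)\tilde w$, $g''\beta_1=(\Sigma u)\tilde w$, $h'\beta_2=v''\beta_1$. (Third hexagon) $\alpha_1v=\tilde vg$, $\alpha_2f'=\tilde vu'$, and $\alpha_1\circ\Sigma^{-1}h''=-\alpha_2\circ\Sigma^{-1}w''$ as maps $\Sigma^{-1}Z''\to A$.
   Context: $\mathcal{T}$ is a triangulated category with self-equivalence $\Sigma$; the natural isomorphisms $\Sigma\Sigma^{-1}\cong 1\cong\Sigma^{-1}\Sigma$ are suppressed. "Exact triangle" or "triangle" means distinguished triangle. A map of triangles $(f,g,h)$ from $X\xrightarrow{u}Y\xrightarrow{v}Z\xrightarrow{w}\Sigma X$ to $X'\xrightarrow{u'}Y'\xrightarrow{v'}Z'\xrightarrow{w'}\Sigma X'$ consists of $f\colon X\to X'$, $g\colon Y\to Y'$, $h\colon Z\to Z'$ with $gu=u'f$, $hv=v'g$, $(\Sigma f)w=w'h$. Octahedra: given composable maps $P\xrightarrow{a}Q\xrightarrow{b}R$ and exact triangles $P\xrightarrow{a}Q\xrightarrow{a'}C_a\xrightarrow{a''}\Sigma P$, $Q\xrightarrow{b}R\xrightarrow{b'}C_b\xrightarrow{b''}\Sigma Q$, $P\xrightarrow{ba}R\xrightarrow{c'}C\xrightarrow{c''}\Sigma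 P$, an octahedron for the composite $ba$ consists of maps $\alpha\colon C_a\to C$, $\beta\colon C\to C_b$, $\gamma\colon C_b\to\Sigma C_a$ such that $C_a\xrightarrow{\alpha}C\xrightarrow{\beta}C_b\xrightarrow{\gamma}\Sigma C_a$ is exact and $\alpha a'=c'b$, $c''\alpha=a''$, $\beta c'=b'$, $\gamma=(\Sigma a')b''$, $b''\beta=(\Sigma a)c''$. Verdier good: choose exact triangles $X\xrightarrow{f}X'\xrightarrow{f'}X''\xrightarrow{f''}\Sigma X$, $Y\xrightarrow{g}Y'\xrightarrow{g'}Y''\xrightarrow{g''}\Sigma Y$ and $X\xrightarrow{gu=u'f}Y'\xrightarrow{\tilde v}A\xrightarrow{\tilde w}\Sigma X$. The map $(f,g,h)$ is Verdier good if there exist an octahedron $(\alpha_1\colon Z\to A,\ \beta_1\colon A\to Y'',\ \gamma_1)$ for the composite $X\xrightarrow{u}Y\xrightarrow{g}Y'$ and an octahedron $(\alpha_2\colon X''\to A,\ \beta_2\colon A\to Z',\ \gamma_2)$ for the composite $X\xrightarrow{f}X'\xrightarrow{u'}Y'$ (both using the given and chosen triangles, in particular the same triangle on $gu=u'f$) such that $h=\beta_2\alpha_1$. This does not depend on the chosen triangles. *)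

theory Defs
  imports "HOL-Algebra.Group"
begin

section \<open>Categories\<close>

record ('o, 'm) cat =
  Ob :: "'o set"
  Ar :: "'m set"
  Dom :: "'m \<Rightarrow> 'o"
  Cod :: "'m \<Rightarrow> 'o"
  Id :: "'o \<Rightarrow> 'm"
  Comp :: "'m \<Rightarrow> 'm \<Rightarrow> 'm" (infixl "\<cdot>\<index>" 70)

definition Hom :: "('o, 'm, 'z) cat_scheme \<Rightarrow> 'o \<Rightarrow> 'o \<Rightarrow> 'm set" where
  "Hom C X Y = {f \<in> Ar C. Dom C f = X \<and> Cod C f = Y}"

text \<open>As usual, \<open>g \<cdot> f\<close> means first \<open>f\<close>, then \<open>g\<close>.\<close>

locale category =
  fixes C :: "('o, 'm, 'z) cat_scheme" (structure)
  assumes dom_ob: "f \<in> Ar C \<Longrightarrow> Dom C f \<in> Ob C"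
    and cod_ob: "f \<in> Ar C \<Longrightarrow> Cod C f \<in> Ob C"
    and id_hom: "X \<in> Ob C \<Longrightarrow> Id C X \<in> Hom C X X"
    and comp_hom: "\<lbrakk>f \<in> Hom C X Y; g \<in> Hom C Y Z\<rbrakk> \<Longrightarrow> g \<cdot> f \<in> Hom C X Z"
    and comp_id: "f \<in> Hom C X Y \<Longrightarrow> f \<cdot> Id C X = f"
    and id_comp: "f \<in> Hom C X Y \<Longrightarrow> Id C Y \<cdot> f = f"
    and comp_assoc:
      "\<lbrakk>f \<in> Hom C W X; g \<in> Hom C X Y; h \<in> Hom C Y Z\<rbrakk> \<Longrightarrow> (h \<cdot> g) \<cdot> f = h \<cdot> (g \<cdot> f)"

definition is_iso :: "('o, 'm, 'z) cat_scheme \<Rightarrow> 'm \<Rightarrow> bool" where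
  "is_iso C f \<longleftrightarrow> f \<in> Ar C \<and>
     (\<exists>g \<in> Hom C (Cod C f) (Dom C f).
        Comp C g f = Id C (Dom C f) \<and> Comp C f g = Id C (Cod C f))"

definition zero_object :: "('o, 'm, 'z) cat_scheme \<Rightarrow> 'o \<Rightarrow> bool" where
  "zero_object C N \<longleftrightarrow> N \<in> Ob C \<and>
     (\<forall>X \<in> Ob C. (\<exists>!f. f \<in> Hom C N X) \<and> (\<exists>!f. f \<in> Hom C X N))"

definition endofunctor ::
  "('o, 'm, 'z) cat_scheme \<Rightarrow> ('o \<Rightarrow> 'o) \<Rightarrow> ('m \<Rightarrow> 'm) \<Rightarrow> bool" where
  "endofunctor C Fo Fm \<longleftrightarrow>
     (\<forall>X \<in> Ob C. Fo X \<in> Ob C \<and> Fm (Id C X) = Id C (Fo X)) \<and>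
     (\<forall>X \<in> Ob C. \<forall>Y \<in> Ob C. \<forall>f \<in> Hom C X Y. Fm f \<in> Hom C (Fo X) (Fo Y)) \<and>
     (\<forall>X \<in> Ob C. \<forall>Y \<in> Ob C. \<forall>Z \<in> Ob C. \<forall>f \<in> Hom C X Y. \<forall>g \<in> Hom C Y Z.
        Fm (Comp C g f) = Comp C (Fm g) (Fm f))"

definition natural_iso ::
  "('o, 'm, 'z) cat_scheme \<Rightarrow> ('o \<Rightarrow> 'o) \<Rightarrow> ('m \<Rightarrow> 'm) \<Rightarrow> ('o \<Rightarrow> 'o) \<Rightarrow> ('m \<Rightarrow> 'm)
     \<Rightarrow> ('o \<Rightarrow> 'm) \<Rightarrow> bool" where
  "natural_iso C Fo Fm Go Gm \<tau> \<longleftrightarrow>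
     (\<forall>X \<in> Ob C. \<tau> X \<in> Hom C (Fo X) (Go X) \<and> is_iso C (\<tau> X)) \<and>
     (\<forall>X \<in> Ob C. \<forall>Y \<in> Ob C. \<forall>f \<in> Hom C X Y. Comp C (\<tau> Y) (Fm f) = Comp C (Gm f) (\<tau> X))"


section \<open>Additive categories\<close>

record ('o, 'm) preadd_cat = "('o, 'm) cat" +
  zero_mor :: "'o \<Rightarrow> 'o \<Rightarrow> 'm"
  add_mor :: "'m \<Rightarrow> 'm \<Rightarrow> 'm" (infixl "\<boxplus>\<index>" 65)

definition hom_group :: "('o, 'm, 'z) preadd_cat_scheme \<Rightarrow> 'o \<Rightarrow> 'o \<Rightarrow> 'm monoid" where
  "hom_group C X Y = \<lparr>carrier = Hom C X Y, mult = add_mor C, one = zero_mor C X Y\<rparr>"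

definition neg_mor :: "('o, 'm, 'z) preadd_cat_scheme \<Rightarrow> 'm \<Rightarrow> 'm" ("\<boxminus>\<index> _" [81] 80) where
  "neg_mor C f = inv\<^bsub>hom_group C (Dom C f) (Cod C f)\<^esub> f"

locale preadditive_category = category C
  for C :: "('o, 'm, 'z) preadd_cat_scheme" (structure) +
  assumes hom_comm_group: "\<lbrakk>X \<in> Ob C; Y \<in> Ob C\<rbrakk> \<Longrightarrow> comm_group (hom_group C X Y)"
    and comp_add: "\<lbrakk>f \<in> Hom C X Y; f' \<in> Hom C X Y; g \<in> Hom C Y Z\<rbrakk>
      \<Longrightarrow> g \<cdot> (f \<boxplus> f') = (g \<cdot> f) \<boxplus> (g \<cdot> f')"
    and add_comp: "\<lbrakk>f \<in> Hom C X Y; g \<in> Hom C Y Z; g' \<in> Hom C Y Z\<rbrakk>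
      \<Longrightarrow> (g \<boxplus> g') \<cdot> f = (g \<cdot> f) \<boxplus> (g' \<cdot> f)"

definition biproduct ::
  "('o, 'm, 'z) preadd_cat_scheme \<Rightarrow> 'o \<Rightarrow> 'o \<Rightarrow> 'o \<Rightarrow> 'm \<Rightarrow> 'm \<Rightarrow> 'm \<Rightarrow> 'm \<Rightarrow> bool" where
  "biproduct C X Y B i j p q \<longleftrightarrow> B \<in> Ob C \<and>
     i \<in> Hom C X B \<and> j \<in> Hom C Y B \<and> p \<in> Hom C B X \<and> q \<in> Hom C B Y \<and>
     Comp C p i = Id C X \<and> Comp C q j = Id C Y \<and>
     Comp C p j = zero_mor C Y X \<and> Comp C q i = zero_mor C X Y \<and>
     add_mor C (Comp C i p) (Comp C j q) = Id C B"

locale additive_category = preadditive_category C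
  for C :: "('o, 'm, 'z) preadd_cat_scheme" (structure) +
  assumes has_zero_object: "\<exists>N. zero_object C N"
    and has_biproducts: "\<lbrakk>X \<in> Ob C; Y \<in> Ob C\<rbrakk> \<Longrightarrow> \<exists>B i j p q. biproduct C X Y B i j p q"


section \<open>Triangulated categories\<close>

text \<open>
  The suspension is only an equivalence, so a quasi-inverse \<open>\<Sigma>\<^sup>-\<close> and natural isomorphisms
  \<open>\<Sigma>\<^sup>- \<Sigma> \<cong> 1\<close> (\<open>unsh_sh\<close>) and \<open>\<Sigma> \<Sigma>\<^sup>- \<cong> 1\<close> (\<open>sh_unsh\<close>) belong to the data. The two isomorphisms
  are not required to satisfy the triangle identities of an adjoint equivalence.
\<close>

record ('o, 'm) tri_cat = "('o, 'm) preadd_cat" +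
  sh_ob :: "'o \<Rightarrow> 'o" ("\<Sigma>\<^sub>o\<index>")
  sh :: "'m \<Rightarrow> 'm" ("\<Sigma>\<index>")
  unsh_ob :: "'o \<Rightarrow> 'o" ("\<Sigma>\<^sup>-\<^sub>o\<index>")
  unsh :: "'m \<Rightarrow> 'm" ("\<Sigma>\<^sup>-\<index>")
  unsh_sh :: "'o \<Rightarrow> 'm"
  sh_unsh :: "'o \<Rightarrow> 'm"
  Tri :: "('m \<times> 'm \<times> 'm) set"

definition candidate_triangle ::
  "('o, 'm, 'z) tri_cat_scheme \<Rightarrow> 'o \<Rightarrow> 'm \<Rightarrow> 'o \<Rightarrow> 'm \<Rightarrow> 'o \<Rightarrow> 'm \<Rightarrow> bool" where
  "candidate_triangle T X u Y v Z w \<longleftrightarrow>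
     X \<in> Ob T \<and> Y \<in> Ob T \<and> Z \<in> Ob T \<and>
     u \<in> Hom T X Y \<and> v \<in> Hom T Y Z \<and> w \<in> Hom T Z (sh_ob T X)"

definition exact_triangle ::
  "('o, 'm, 'z) tri_cat_scheme \<Rightarrow> 'o \<Rightarrow> 'm \<Rightarrow> 'o \<Rightarrow> 'm \<Rightarrow> 'o \<Rightarrow> 'm \<Rightarrow> bool" where
  "exact_triangle T X u Y v Z w \<longleftrightarrow> candidate_triangle T X u Y v Z w \<and> (u, v, w) \<in> Tri T"

definition triangle_map ::
  "('o, 'm, 'z) tri_cat_scheme
     \<Rightarrow> 'o \<Rightarrow> 'm \<Rightarrow> 'o \<Rightarrow> 'm \<Rightarrow> 'o \<Rightarrow> 'm \<Rightarrow> 'o \<Rightarrow> 'm \<Rightarrow> 'o \<Rightarrow> 'm \<Rightarrow> 'o \<Rightarrow> 'm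
     \<Rightarrow> 'm \<Rightarrow> 'm \<Rightarrow> 'm \<Rightarrow> bool" where
  "triangle_map T X u Y v Z w X' u' Y' v' Z' w' f g h \<longleftrightarrow>
     f \<in> Hom T X X' \<and> g \<in> Hom T Y Y' \<and> h \<in> Hom T Z Z' \<and>
     Comp T g u = Comp T u' f \<and> Comp T h v = Comp T v' g \<and>
     Comp T (sh T f) w = Comp T w' h"

text \<open>
  \<open>(\<alpha>, \<beta>, \<gamma>)\<close> is an octahedron for the composite \<open>b \<cdot> a\<close> of \<open>a : P \<rightarrow> Q\<close> and \<open>b : Q \<rightarrow> R\<close>,
  relative to triangles \<open>(a, a', a'')\<close>, \<open>(b, b', b'')\<close>, \<open>(b \<cdot> a, c', c'')\<close> with third objects
  \<open>Ca\<close>, \<open>Cb\<close>, \<open>K\<close>. That these three triangles are exact is stated wherever the notion is used.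
\<close>

definition octahedron ::
  "('o, 'm, 'z) tri_cat_scheme \<Rightarrow> 'm \<Rightarrow> 'm \<Rightarrow> 'm \<Rightarrow> 'o \<Rightarrow> 'm \<Rightarrow> 'm \<Rightarrow> 'm \<Rightarrow> 'o
     \<Rightarrow> 'm \<Rightarrow> 'm \<Rightarrow> 'o \<Rightarrow> 'm \<Rightarrow> 'm \<Rightarrow> 'm \<Rightarrow> bool" where
  "octahedron T a a' a'' Ca b b' b'' Cb c' c'' K \<alpha> \<beta> \<gamma> \<longleftrightarrow>
     exact_triangle T Ca \<alpha> K \<beta> Cb \<gamma> \<and>
     Comp T \<alpha> a' = Comp T c' b \<and>
     Comp T c'' \<alpha> = a'' \<and>
     Comp T \<beta> c' = b' \<and>
     \<gamma> = Comp T (sh T a') b'' \<and>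
     Comp T b'' \<beta> = Comp T (sh T a) c''"

locale triangulated_category = additive_category T
  for T :: "('o, 'm, 'z) tri_cat_scheme" (structure) +
  assumes shift_functor: "endofunctor T \<Sigma>\<^sub>o \<Sigma>"
    and shift_add: "\<lbrakk>f \<in> Hom T X Y; g \<in> Hom T X Y\<rbrakk> \<Longrightarrow> \<Sigma> (f \<boxplus> g) = \<Sigma> f \<boxplus> \<Sigma> g"
    and unshift_functor: "endofunctor T \<Sigma>\<^sup>-\<^sub>o \<Sigma>\<^sup>-"
    and unshift_shift: "natural_iso T (\<Sigma>\<^sup>-\<^sub>o \<circ> \<Sigma>\<^sub>o) (\<Sigma>\<^sup>- \<circ> \<Sigma>) id id (unsh_sh T)"
    and shift_unshift: "natural_iso T (\<Sigma>\<^sub>o \<circ> \<Sigma>\<^sup>-\<^sub>o) (\<Sigma> \<circ> \<Sigma>\<^sup>-) id id (sh_unsh T)"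
    and TR1_iso:
      "\<lbrakk>exact_triangle T X u Y v Z w; candidate_triangle T X' u' Y' v' Z' w';
        triangle_map T X u Y v Z w X' u' Y' v' Z' w' f g h;
        is_iso T f; is_iso T g; is_iso T h\<rbrakk>
       \<Longrightarrow> exact_triangle T X' u' Y' v' Z' w'"
    and TR1_id:
      "\<lbrakk>X \<in> Ob T; zero_object T N\<rbrakk>
       \<Longrightarrow> exact_triangle T X (Id T X) X (zero_mor T X N) N (zero_mor T N (\<Sigma>\<^sub>o X))"
    and TR1_ex:
      "\<lbrakk>X \<in> Ob T; Y \<in> Ob T; u \<in> Hom T X Y\<rbrakk> \<Longrightarrow> \<exists>Z v w. exact_triangle T X u Y v Z w"
    and TR2:
      "candidate_triangle T X u Y v Z w
       \<Longrightarrow> exact_triangle T X u Y v Z w \<longleftrightarrow> exact_triangle T Y v Z w (\<Sigma>\<^sub>o X) (\<boxminus> (\<Sigma> u))"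
    and TR3:
      "\<lbrakk>exact_triangle T X u Y v Z w; exact_triangle T X' u' Y' v' Z' w';
        f \<in> Hom T X X'; g \<in> Hom T Y Y'; g \<cdot> u = u' \<cdot> f\<rbrakk>
       \<Longrightarrow> \<exists>h. triangle_map T X u Y v Z w X' u' Y' v' Z' w' f g h"
    and TR4:
      "\<lbrakk>exact_triangle T P a Q a' Ca a''; exact_triangle T Q b R b' Cb b'';
        exact_triangle T P (b \<cdot> a) R c' K c''\<rbrakk>
       \<Longrightarrow> \<exists>\<alpha> \<beta> \<gamma>. octahedron T a a' a'' Ca b b' b'' Cb c' c'' K \<alpha> \<beta> \<gamma>"


section \<open>Verdier good maps of triangles\<close>

text \<open>
  Both octahedra use the same triangle on \<open>g \<cdot> u = u' \<cdot> f\<close>. Whether a map of triangles is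
  Verdier good does not depend on the auxiliary triangles, which are existentially quantified here.
\<close>

definition verdier_good ::
  "('o, 'm, 'z) tri_cat_scheme
     \<Rightarrow> 'o \<Rightarrow> 'm \<Rightarrow> 'o \<Rightarrow> 'm \<Rightarrow> 'o \<Rightarrow> 'm \<Rightarrow> 'o \<Rightarrow> 'm \<Rightarrow> 'o \<Rightarrow> 'm \<Rightarrow> 'o \<Rightarrow> 'm
     \<Rightarrow> 'm \<Rightarrow> 'm \<Rightarrow> 'm \<Rightarrow> bool" where
  "verdier_good T X u Y v Z w X' u' Y' v' Z' w' f g h \<longleftrightarrow>
     (\<exists>X'' f' f'' Y'' g' g'' A vt wt \<alpha>1 \<beta>1 \<gamma>1 \<alpha>2 \<beta>2 \<gamma>2.
        exact_triangle T X f X' f' X'' f'' \<and>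
        exact_triangle T Y g Y' g' Y'' g'' \<and>
        exact_triangle T X (Comp T g u) Y' vt A wt \<and>
        octahedron T u v w Z g g' g'' Y'' vt wt A \<alpha>1 \<beta>1 \<gamma>1 \<and>
        octahedron T f f' f'' X'' u' v' w' Z' vt wt A \<alpha>2 \<beta>2 \<gamma>2 \<and>
        h = Comp T \<beta>2 \<alpha>1)"

end

theory Submission
  imports Defs
begin

text \<open>
  The conditions of the hexagons are those of the two octahedra together with identities involving
  the third row and column. To produce these from a Verdier good map, apply the octahedral axiom
  once more, to the factorization \<open>h = \<beta>2 \<cdot> \<alpha>1\<close>, with the triangle of the first octahedron on \<open>\<alpha>1\<close>
  and the rotated triangle of the second on \<open>\<beta>2\<close>. The rotation is the source of the sign in
  \<open>\<Sigma> f'' \<cdot> w'' = \<boxminus> (\<Sigma> w \<cdot> h'')\<close>.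
\<close>

section \<open>Cancellation of isomorphisms\<close>

context category
begin

lemma hom_ob:
  assumes "f \<in> Hom C X Y"
  shows "X \<in> Ob C" "Y \<in> Ob C"
  using assms dom_ob cod_ob by (auto simp: Hom_def)

lemma iso_right_cancel:
  assumes t: "t \<in> Hom C X Y" "is_iso C t"
    and a: "a \<in> Hom C Y Z" and b: "b \<in> Hom C Y Z"
    and eq: "a \<cdot> t = b \<cdot> t"
  shows "a = b"
proof -
  obtain s where s: "s \<in> Hom C Y X" "t \<cdot> s = Id C Y"
    using t by (auto simp: is_iso_def Hom_def)
  have "a = (a \<cdot> t) \<cdot> s"
    using s comp_assoc[OF s(1) t(1) a] comp_id[OF a] by simp
  also have "\<dots> = b"
    using s comp_assoc[OF s(1) t(1) b] comp_id[OF b] eq by simp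
  finally show ?thesis .
qed

lemma iso_left_cancel:
  assumes t: "t \<in> Hom C Y Z" "is_iso C t"
    and a: "a \<in> Hom C X Y" and b: "b \<in> Hom C X Y"
    and eq: "t \<cdot> a = t \<cdot> b"
  shows "a = b"
proof -
  obtain s where s: "s \<in> Hom C Z Y" "s \<cdot> t = Id C Y"
    using t by (auto simp: is_iso_def Hom_def)
  have "a = s \<cdot> (t \<cdot> a)"
    using s comp_assoc[OF a t(1) s(1)] id_comp[OF a] by simp
  also have "\<dots> = b"
    using s comp_assoc[OF b t(1) s(1)] id_comp[OF b] eq by simp
  finally show ?thesis .
qed

end

section \<open>Negation of morphisms\<close>

context preadditive_category
begin

lemma neg_mor_eq:
  "f \<in> Hom C X Y \<Longrightarrow> \<boxminus> f = inv\<^bsub>hom_group C X Y\<^esub> f"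
  by (auto simp: neg_mor_def Hom_def)

lemma hom_group_group: "f \<in> Hom C X Y \<Longrightarrow> group (hom_group C X Y)"
  using hom_comm_group hom_ob comm_group.axioms(2) by blast

lemma neg_hom:
  assumes "f \<in> Hom C X Y"
  shows "\<boxminus> f \<in> Hom C X Y"
  using group.inv_closed[OF hom_group_group[OF assms], of f] assms
  by (simp add: neg_mor_eq hom_group_def)

lemma add_neg:
  assumes "f \<in> Hom C X Y"
  shows "f \<boxplus> \<boxminus> f = zero_mor C X Y"
  using group.r_inv[OF hom_group_group[OF assms], of f] assms
  by (simp add: neg_mor_eq hom_group_def)

lemma neg_unique:
  assumes "f \<in> Hom C X Y" "g \<in> Hom C X Y" "f \<boxplus> g = zero_mor C X Y"
  shows "g = \<boxminus> f"
  using group.inv_equality[OF hom_group_group[OF assms(1)], of g f]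
    comm_groupE(4)[OF hom_comm_group[OF hom_ob[OF assms(1)]], of f g] assms
  by (simp add: neg_mor_eq hom_group_def)

lemma neg_neg:
  assumes "f \<in> Hom C X Y"
  shows "\<boxminus> (\<boxminus> f) = f"
  using group.inv_inv[OF hom_group_group[OF assms], of f] assms neg_hom[OF assms]
  by (simp add: neg_mor_eq hom_group_def)

lemma zero_hom:
  "X \<in> Ob C \<Longrightarrow> Y \<in> Ob C \<Longrightarrow> zero_mor C X Y \<in> Hom C X Y"
  using comm_groupE(2)[OF hom_comm_group] by (simp add: hom_group_def)

lemma idempotent_zero:
  assumes "f \<in> Hom C X Y" "f \<boxplus> f = f"
  shows "f = zero_mor C X Y"
  using group.l_cancel_one[OF hom_group_group[OF assms(1)], of f f] assms
  by (simp add: hom_group_def)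

lemma zero_add_zero:
  assumes "X \<in> Ob C" "Y \<in> Ob C"
  shows "zero_mor C X Y \<boxplus> zero_mor C X Y = zero_mor C X Y"
  using comm_groupE(5)[OF hom_comm_group[OF assms], of "zero_mor C X Y"] zero_hom[OF assms]
  by (simp add: hom_group_def)

text \<open>The image of zero is idempotent, hence zero, and negatives are unique. The abstract
  \<open>F\<close> covers composition on either side as well as \<open>\<Sigma>\<close>.\<close>

lemma additive_neg:
  assumes add: "\<And>a b. a \<in> Hom C X Y \<Longrightarrow> b \<in> Hom C X Y \<Longrightarrow> F (a \<boxplus> b) = F a \<boxplus> F b"
    and hom: "\<And>a. a \<in> Hom C X Y \<Longrightarrow> F a \<in> Hom C X' Y'"
    and f: "f \<in> Hom C X Y"
  shows "F (\<boxminus> f) = \<boxminus> (F f)"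
proof (rule neg_unique)
  note XY = hom_ob[OF f]
  have "F (zero_mor C X Y) = zero_mor C X' Y'"
    using add[OF zero_hom zero_hom] hom[OF zero_hom] zero_add_zero XY
    by (intro idempotent_zero) auto
  then show "F f \<boxplus> F (\<boxminus> f) = zero_mor C X' Y'"
    using add[OF f neg_hom[OF f]] add_neg[OF f] by simp
qed (use hom f neg_hom in auto)

lemma comp_neg:
  assumes "f \<in> Hom C X Y" "g \<in> Hom C Y Z"
  shows "g \<cdot> \<boxminus> f = \<boxminus> (g \<cdot> f)"
  by (rule additive_neg[where F = "\<lambda>a. g \<cdot> a"]) (use assms comp_add comp_hom in auto)

lemma neg_comp:
  assumes "f \<in> Hom C X Y" "g \<in> Hom C Y Z"
  shows "\<boxminus> g \<cdot> f = \<boxminus> (g \<cdot> f)"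
  by (rule additive_neg[where F = "\<lambda>a. a \<cdot> f"]) (use assms add_comp comp_hom in auto)

end

section \<open>Signs and transposition for the suspension and its quasi-inverse\<close>

context triangulated_category
begin

lemma shift_hom: "f \<in> Hom T X Y \<Longrightarrow> \<Sigma> f \<in> Hom T (\<Sigma>\<^sub>o X) (\<Sigma>\<^sub>o Y)"
  using shift_functor hom_ob by (simp add: endofunctor_def)

lemma shift_comp:
  "f \<in> Hom T X Y \<Longrightarrow> g \<in> Hom T Y Z \<Longrightarrow> \<Sigma> (g \<cdot> f) = \<Sigma> g \<cdot> \<Sigma> f"
  using shift_functor hom_ob unfolding endofunctor_def by blast

lemma unshift_hom: "f \<in> Hom T X Y \<Longrightarrow> \<Sigma>\<^sup>- f \<in> Hom T (\<Sigma>\<^sup>-\<^sub>o X) (\<Sigma>\<^sup>-\<^sub>o Y)"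
  using unshift_functor hom_ob by (simp add: endofunctor_def)

lemma unshift_comp:
  "f \<in> Hom T X Y \<Longrightarrow> g \<in> Hom T Y Z \<Longrightarrow> \<Sigma>\<^sup>- (g \<cdot> f) = \<Sigma>\<^sup>- g \<cdot> \<Sigma>\<^sup>- f"
  using unshift_functor hom_ob unfolding endofunctor_def by blast

lemma shift_neg: "f \<in> Hom T X Y \<Longrightarrow> \<Sigma> (\<boxminus> f) = \<boxminus> (\<Sigma> f)"
  by (rule additive_neg[where F = \<Sigma>]) (use shift_add shift_hom in auto)

lemma unsh_sh_iso:
  assumes "X \<in> Ob T"
  shows "unsh_sh T X \<in> Hom T (\<Sigma>\<^sup>-\<^sub>o (\<Sigma>\<^sub>o X)) X" "is_iso T (unsh_sh T X)"
  using unshift_shift assms by (auto simp: natural_iso_def)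

lemma sh_unsh_iso:
  assumes "X \<in> Ob T"
  shows "sh_unsh T X \<in> Hom T (\<Sigma>\<^sub>o (\<Sigma>\<^sup>-\<^sub>o X)) X" "is_iso T (sh_unsh T X)"
  using shift_unshift assms by (auto simp: natural_iso_def)

lemma unsh_sh_natural:
  "f \<in> Hom T X Y \<Longrightarrow> unsh_sh T Y \<cdot> \<Sigma>\<^sup>- (\<Sigma> f) = f \<cdot> unsh_sh T X"
  using unshift_shift hom_ob by (simp add: natural_iso_def)

lemma sh_unsh_natural:
  "f \<in> Hom T X Y \<Longrightarrow> sh_unsh T Y \<cdot> \<Sigma> (\<Sigma>\<^sup>- f) = f \<cdot> sh_unsh T X"
  using shift_unshift hom_ob by (simp add: natural_iso_def)

text \<open>Naturality of \<open>unsh_sh\<close> recovers \<open>a \<cdot> unsh_sh T X\<close> from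
  \<open>\<Sigma> a\<close>, and \<open>unsh_sh T X\<close> cancels.\<close>

lemma shift_faithful:
  assumes "a \<in> Hom T X Y" "b \<in> Hom T X Y" "\<Sigma> a = \<Sigma> b"
  shows "a = b"
  using iso_right_cancel[OF unsh_sh_iso[OF hom_ob(1)[OF assms(1)]] assms(1,2)]
    unsh_sh_natural[OF assms(1)] unsh_sh_natural[OF assms(2)] assms(3) by simp

text \<open>
  Additivity of \<open>\<Sigma>\<^sup>-\<close> is not part of the axioms, but \<open>\<Sigma> \<Sigma>\<^sup>-\<close> is isomorphic to the identity and
  \<open>\<Sigma>\<close> is faithful and additive.
\<close>

lemma unshift_neg:
  assumes f: "f \<in> Hom T X Y"
  shows "\<Sigma>\<^sup>- (\<boxminus> f) = \<boxminus> (\<Sigma>\<^sup>- f)"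
proof (rule shift_faithful)
  note uf = unshift_hom[OF f] and nf = neg_hom[OF f]
  note XY = hom_ob[OF f]
  show "\<Sigma>\<^sup>- (\<boxminus> f) \<in> Hom T (\<Sigma>\<^sup>-\<^sub>o X) (\<Sigma>\<^sup>-\<^sub>o Y)" "\<boxminus> (\<Sigma>\<^sup>- f) \<in> Hom T (\<Sigma>\<^sup>-\<^sub>o X) (\<Sigma>\<^sup>-\<^sub>o Y)"
    using unshift_hom[OF nf] neg_hom[OF uf] by auto
  show "\<Sigma> (\<Sigma>\<^sup>- (\<boxminus> f)) = \<Sigma> (\<boxminus> (\<Sigma>\<^sup>- f))"
  proof (rule iso_left_cancel[OF sh_unsh_iso[OF XY(2)]])
    \<comment> \<open>Naturality of \<open>sh_unsh\<close> at \<open>\<boxminus> f\<close> and at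
      \<open>f\<close> brings both sides to the same negative.\<close>
    have "sh_unsh T Y \<cdot> \<Sigma> (\<Sigma>\<^sup>- (\<boxminus> f)) = \<boxminus> (f \<cdot> sh_unsh T X)"
      using sh_unsh_natural[OF nf] neg_comp[OF sh_unsh_iso(1)[OF XY(1)] f] by simp
    also have "\<dots> = sh_unsh T Y \<cdot> \<Sigma> (\<boxminus> (\<Sigma>\<^sup>- f))"
      using sh_unsh_natural[OF f] comp_neg[OF shift_hom[OF uf] sh_unsh_iso(1)[OF XY(2)]]
        shift_neg[OF uf] by simp
    finally show "sh_unsh T Y \<cdot> \<Sigma> (\<Sigma>\<^sup>- (\<boxminus> f)) = sh_unsh T Y \<cdot> \<Sigma> (\<boxminus> (\<Sigma>\<^sup>- f))" .
  qed (use shift_hom unshift_hom neg_hom f in blast)+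
qed

text \<open>Naturality of \<open>unsh_sh\<close> moves \<open>a\<close> under
  \<open>\<Sigma>\<^sup>-\<close>. An identity between maps into \<open>\<Sigma>\<^sub>o A\<close>
  thus becomes one between maps into \<open>A\<close>, which is the form of the last condition of
  the third hexagon.\<close>

lemma unshift_transpose:
  assumes a: "a \<in> Hom T X A" and p: "p \<in> Hom T W (\<Sigma>\<^sub>o X)"
  shows "a \<cdot> (unsh_sh T X \<cdot> \<Sigma>\<^sup>- p) = unsh_sh T A \<cdot> \<Sigma>\<^sup>- (\<Sigma> a \<cdot> p)"
proof -
  note u = unsh_sh_iso(1)[OF hom_ob(1)[OF a]] unsh_sh_iso(1)[OF hom_ob(2)[OF a]]
  note sa = shift_hom[OF a]
  have "a \<cdot> (unsh_sh T X \<cdot> \<Sigma>\<^sup>- p) = (unsh_sh T A \<cdot> \<Sigma>\<^sup>- (\<Sigma> a)) \<cdot> \<Sigma>\<^sup>- p"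
    using comp_assoc[OF unshift_hom[OF p] u(1) a] unsh_sh_natural[OF a] by simp
  also have "\<dots> = unsh_sh T A \<cdot> \<Sigma>\<^sup>- (\<Sigma> a \<cdot> p)"
    using comp_assoc[OF unshift_hom[OF p] unshift_hom[OF sa] u(2)] unshift_comp[OF p sa] by simp
  finally show ?thesis .
qed

section \<open>Rotation and cones of composites\<close>

lemma exact_triangle_hom:
  assumes "exact_triangle T X u Y v Z w"
  shows "u \<in> Hom T X Y" "v \<in> Hom T Y Z" "w \<in> Hom T Z (\<Sigma>\<^sub>o X)"
  using assms by (auto simp: exact_triangle_def candidate_triangle_def)

lemma rotate:
  "exact_triangle T X u Y v Z w \<Longrightarrow> exact_triangle T Y v Z w (\<Sigma>\<^sub>o X) (\<boxminus> (\<Sigma> u))"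
  using TR2 by (auto simp: exact_triangle_def)

text \<open>The rotated triangle only types \<open>\<Sigma> u\<close>, so the domain and codomain of
  \<open>u\<close> have to be assumed separately before \<open>TR2\<close> applies.\<close>

lemma rotate_back:
  assumes "exact_triangle T Y v Z w (\<Sigma>\<^sub>o X) (\<boxminus> (\<Sigma> u))" "u \<in> Hom T X Y"
  shows "exact_triangle T X u Y v Z w"
proof -
  have "candidate_triangle T X u Y v Z w"
    using assms hom_ob by (auto simp: exact_triangle_def candidate_triangle_def)
  then show ?thesis using TR2 assms(1) by blast
qed

text \<open>In an octahedron for \<open>\<beta>2 \<cdot> \<alpha>1\<close>, the triangle through the
  three cones is \<open>Y''\<close>, \<open>Z''\<close>, \<open>\<Sigma>\<^sub>o X''\<close>;
  rotated back it becomes the third row of the diagram. The octahedral identities supply the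
  relations with \<open>h'\<close> and \<open>h''\<close>.\<close>

lemma cone_of_composite:
  assumes tri1: "exact_triangle T Z \<alpha>1 A \<beta>1 Y'' p"
    and tri2: "exact_triangle T X'' \<alpha>2 A \<beta>2 Z' q"
  obtains Z'' h' h'' v'' w'' where
    "exact_triangle T Z (\<beta>2 \<cdot> \<alpha>1) Z' h' Z'' h''"
    "exact_triangle T X'' (\<beta>1 \<cdot> \<alpha>2) Y'' v'' Z'' w''"
    "h' \<cdot> \<beta>2 = v'' \<cdot> \<beta>1" "h'' \<cdot> v'' = p" "w'' \<cdot> h' = q"
    "\<Sigma> \<alpha>1 \<cdot> h'' = \<boxminus> (\<Sigma> \<alpha>2 \<cdot> w'')"
proof -
  note h1 = exact_triangle_hom[OF tri1] and h2 = exact_triangle_hom[OF tri2]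
  have hh: "\<beta>2 \<cdot> \<alpha>1 \<in> Hom T Z Z'" and uh: "\<beta>1 \<cdot> \<alpha>2 \<in> Hom T X'' Y''"
    using comp_hom h1 h2 by blast+
  obtain Z'' h' h'' where tri3: "exact_triangle T Z (\<beta>2 \<cdot> \<alpha>1) Z' h' Z'' h''"
    using TR1_ex[OF hom_ob[OF hh] hh] by blast
  obtain v'' w'' \<gamma> where o: "octahedron T \<alpha>1 \<beta>1 p Y'' \<beta>2 q (\<boxminus> (\<Sigma> \<alpha>2)) (\<Sigma>\<^sub>o X'') h' h'' Z'' v'' w'' \<gamma>"
    using TR4[OF tri1 rotate[OF tri2] tri3] by blast
  then have ex: "exact_triangle T Y'' v'' Z'' w'' (\<Sigma>\<^sub>o X'') \<gamma>"
    and eqs: "v'' \<cdot> \<beta>1 = h' \<cdot> \<beta>2" "h'' \<cdot> v'' = p" "w'' \<cdot> h' = q"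
      "\<gamma> = \<Sigma> \<beta>1 \<cdot> \<boxminus> (\<Sigma> \<alpha>2)" "\<boxminus> (\<Sigma> \<alpha>2) \<cdot> w'' = \<Sigma> \<alpha>1 \<cdot> h''"
    by (auto simp: octahedron_def)
  \<comment> \<open>Moving the sign of the rotated triangle outside gives \<open>\<gamma>\<close>
    exactly the shape required for rotating back.\<close>
  have "\<gamma> = \<boxminus> (\<Sigma> (\<beta>1 \<cdot> \<alpha>2))"
    using eqs(4) comp_neg[OF shift_hom[OF h2(1)] shift_hom[OF h1(2)]] shift_comp[OF h2(1) h1(2)]
    by simp
  then have tri4: "exact_triangle T X'' (\<beta>1 \<cdot> \<alpha>2) Y'' v'' Z'' w''"
    using ex rotate_back uh by simp
  have "\<Sigma> \<alpha>1 \<cdot> h'' = \<boxminus> (\<Sigma> \<alpha>2 \<cdot> w'')"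
    using eqs(5) neg_comp[OF exact_triangle_hom(3)[OF tri4] shift_hom[OF h2(1)]] by simp
  then show thesis using that tri3 tri4 eqs by simp
qed

end

section \<open>Verdier good maps and the three hexagons\<close>

theorem lemma3p4:
  fixes T :: "('o, 'm) tri_cat" (structure)
  assumes "triangulated_category T"
    and "exact_triangle T X u Y v Z w"
    and "exact_triangle T X' u' Y' v' Z' w'"
    and "triangle_map T X u Y v Z w X' u' Y' v' Z' w' f g h"
  shows "verdier_good T X u Y v Z w X' u' Y' v' Z' w' f g h \<longleftrightarrow>
    (\<exists>X'' Y'' Z'' f' f'' g' g'' h' h'' u'' v'' w'' A vt wt \<alpha>1 \<beta>1 \<alpha>2 \<beta>2.
       \<comment> \<open>the 4x4 diagram\<close>
       exact_triangle T X f X' f' X'' f'' \<and>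
       exact_triangle T Y g Y' g' Y'' g'' \<and>
       exact_triangle T Z h Z' h' Z'' h'' \<and>
       exact_triangle T X'' u'' Y'' v'' Z'' w'' \<and>
       g' \<cdot> u' = u'' \<cdot> f' \<and> h' \<cdot> v' = v'' \<cdot> g' \<and> \<Sigma> f' \<cdot> w' = w'' \<cdot> h' \<and>
       g'' \<cdot> u'' = \<Sigma> u \<cdot> f'' \<and> h'' \<cdot> v'' = \<Sigma> v \<cdot> g'' \<and> \<Sigma> f'' \<cdot> w'' = \<boxminus> (\<Sigma> w \<cdot> h'') \<and>
       \<comment> \<open>the additional object and maps\<close>
       A \<in> Ob T \<and> vt \<in> Hom T Y' A \<and> wt \<in> Hom T A (\<Sigma>\<^sub>o X) \<and>
       \<alpha>1 \<in> Hom T Z A \<and> \<beta>1 \<in> Hom T A Y'' \<and> \<alpha>2 \<in> Hom T X'' A \<and> \<beta>2 \<in> Hom T A Z' \<and>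
       \<comment> \<open>first hexagon\<close>
       exact_triangle T X (g \<cdot> u) Y' vt A wt \<and>
       exact_triangle T Z \<alpha>1 A \<beta>1 Y'' (\<Sigma> v \<cdot> g'') \<and>
       exact_triangle T X'' \<alpha>2 A \<beta>2 Z' (\<Sigma> f' \<cdot> w') \<and>
       wt \<cdot> \<alpha>1 = w \<and> \<beta>2 \<cdot> vt = v' \<and> \<beta>1 \<cdot> \<alpha>2 = u'' \<and>
       \<beta>2 \<cdot> \<alpha>1 = h \<and> \<beta>1 \<cdot> vt = g' \<and> wt \<cdot> \<alpha>2 = f'' \<and>
       \<comment> \<open>second hexagon\<close>
       w' \<cdot> \<beta>2 = \<Sigma> f \<cdot> wt \<and> g'' \<cdot> \<beta>1 = \<Sigma> u \<cdot> wt \<and> h' \<cdot> \<beta>2 = v'' \<cdot> \<beta>1 \<and>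
       \<comment> \<open>third hexagon; the last identity is between maps from the desuspension of Z'' to A\<close>
       \<alpha>1 \<cdot> v = vt \<cdot> g \<and> \<alpha>2 \<cdot> f' = vt \<cdot> u' \<and>
       \<alpha>1 \<cdot> (unsh_sh T Z \<cdot> \<Sigma>\<^sup>- h'') = \<boxminus> (\<alpha>2 \<cdot> (unsh_sh T X'' \<cdot> \<Sigma>\<^sup>- w'')))"
  (is "?VG \<longleftrightarrow> ?R")
proof -
  interpret triangulated_category T by fact
  show ?thesis
  proof
    assume ?VG
    then obtain X'' f' f'' Y'' g' g'' A vt wt \<alpha>1 \<beta>1 \<gamma>1 \<alpha>2 \<beta>2 \<gamma>2 where
      F: "exact_triangle T X f X' f' X'' f''" and
      G: "exact_triangle T Y g Y' g' Y'' g''" and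
      D: "exact_triangle T X (g \<cdot> u) Y' vt A wt" and
      O1: "octahedron T u v w Z g g' g'' Y'' vt wt A \<alpha>1 \<beta>1 \<gamma>1" and
      O2: "octahedron T f f' f'' X'' u' v' w' Z' vt wt A \<alpha>2 \<beta>2 \<gamma>2" and
      h: "h = \<beta>2 \<cdot> \<alpha>1"
      unfolding verdier_good_def by blast
    \<comment> \<open>The third map of an octahedron is prescribed, so \<open>\<gamma>1\<close> and
      \<open>\<gamma>2\<close> are replaced by \<open>\<Sigma> v \<cdot> g''\<close> and
      \<open>\<Sigma> f' \<cdot> w'\<close>.\<close>
    from O1 have tri1: "exact_triangle T Z \<alpha>1 A \<beta>1 Y'' (\<Sigma> v \<cdot> g'')"
      and o1: "\<alpha>1 \<cdot> v = vt \<cdot> g" "wt \<cdot> \<alpha>1 = w" "\<beta>1 \<cdot> vt = g'" "g'' \<cdot> \<beta>1 = \<Sigma> u \<cdot> wt"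
      by (auto simp: octahedron_def)
    from O2 have tri2: "exact_triangle T X'' \<alpha>2 A \<beta>2 Z' (\<Sigma> f' \<cdot> w')"
      and o2: "\<alpha>2 \<cdot> f' = vt \<cdot> u'" "wt \<cdot> \<alpha>2 = f''" "\<beta>2 \<cdot> vt = v'" "w' \<cdot> \<beta>2 = \<Sigma> f \<cdot> wt"
      by (auto simp: octahedron_def)
    obtain Z'' h' h'' v'' w'' where
      tri3: "exact_triangle T Z h Z' h' Z'' h''" and
      tri4: "exact_triangle T X'' (\<beta>1 \<cdot> \<alpha>2) Y'' v'' Z'' w''" and
      eqs: "h' \<cdot> \<beta>2 = v'' \<cdot> \<beta>1" "h'' \<cdot> v'' = \<Sigma> v \<cdot> g''" "w'' \<cdot> h' = \<Sigma> f' \<cdot> w'"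
        "\<Sigma> \<alpha>1 \<cdot> h'' = \<boxminus> (\<Sigma> \<alpha>2 \<cdot> w'')"
      using cone_of_composite[OF tri1 tri2] h by metis
    note hF = exact_triangle_hom[OF F] and hG = exact_triangle_hom[OF G]
      and hD = exact_triangle_hom[OF D] and h1 = exact_triangle_hom[OF tri1]
      and h2 = exact_triangle_hom[OF tri2] and h3 = exact_triangle_hom[OF tri3]
      and h4 = exact_triangle_hom[OF tri4] and hX' = exact_triangle_hom[OF assms(3)]
    note s = shift_hom[OF h1(1)] shift_hom[OF h2(1)] shift_hom[OF hD(3)]
    \<comment> \<open>The next three squares commute because both of their sides factor through
      \<open>A\<close>.\<close>
    have c1: "g' \<cdot> u' = (\<beta>1 \<cdot> \<alpha>2) \<cdot> f'"
      using comp_assoc[OF hX'(1) hD(2) h1(2)] comp_assoc[OF hF(2) h2(1) h1(2)] o1 o2 by simp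
    have c2: "h' \<cdot> v' = v'' \<cdot> g'"
      using comp_assoc[OF hD(2) h2(2) h3(2)] comp_assoc[OF hD(2) h1(2) h4(2)] o1 o2 eqs by simp
    have c3: "g'' \<cdot> (\<beta>1 \<cdot> \<alpha>2) = \<Sigma> u \<cdot> f''"
      using comp_assoc[OF h2(1) h1(2) hG(3)] o1 o2
        comp_assoc[OF h2(1) hD(3) shift_hom[OF exact_triangle_hom(1)[OF assms(2)]]] by simp
    \<comment> \<open>Since \<open>f'' = wt \<cdot> \<alpha>2\<close> and
      \<open>w = wt \<cdot> \<alpha>1\<close>, the anticommuting square is
      \<open>\<Sigma> wt\<close> applied to \<open>eqs(4)\<close>.\<close>
    have "\<Sigma> f'' \<cdot> w'' = \<Sigma> wt \<cdot> (\<Sigma> \<alpha>2 \<cdot> w'')"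
      using comp_assoc[OF h4(3) s(2,3)] shift_comp[OF h2(1) hD(3)] o2 by simp
    also have "\<dots> = \<Sigma> wt \<cdot> \<boxminus> (\<Sigma> \<alpha>1 \<cdot> h'')"
      using neg_neg[OF comp_hom[OF h4(3) s(2)]] eqs(4) by simp
    also have "\<dots> = \<boxminus> (\<Sigma> wt \<cdot> (\<Sigma> \<alpha>1 \<cdot> h''))"
      using comp_neg[OF comp_hom[OF h3(3) s(1)] s(3)] .
    also have "\<dots> = \<boxminus> (\<Sigma> w \<cdot> h'')"
      using comp_assoc[OF h3(3) s(1,3)] shift_comp[OF h1(1) hD(3)] o1 by simp
    finally have c4: "\<Sigma> f'' \<cdot> w'' = \<boxminus> (\<Sigma> w \<cdot> h'')" .
    \<comment> \<open>Desuspending \<open>eqs(4)\<close> gives the last identity of the third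
      hexagon; the sign passes through \<open>\<Sigma>\<^sup>-\<close> by
      \<open>unshift_neg\<close>.\<close>
    have "\<alpha>1 \<cdot> (unsh_sh T Z \<cdot> \<Sigma>\<^sup>- h'') = unsh_sh T A \<cdot> \<boxminus> (\<Sigma>\<^sup>- (\<Sigma> \<alpha>2 \<cdot> w''))"
      using unshift_transpose[OF h1(1) h3(3)] eqs(4) unshift_neg[OF comp_hom[OF h4(3) s(2)]] by simp
    also have "\<dots> = \<boxminus> (unsh_sh T A \<cdot> \<Sigma>\<^sup>- (\<Sigma> \<alpha>2 \<cdot> w''))"
      using comp_neg[OF unshift_hom[OF comp_hom[OF h4(3) s(2)]]
          unsh_sh_iso(1)[OF hom_ob(2)[OF h1(1)]]] .
    also have "\<dots> = \<boxminus> (\<alpha>2 \<cdot> (unsh_sh T X'' \<cdot> \<Sigma>\<^sup>- w''))"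
      using unshift_transpose[OF h2(1) h4(3)] by simp
    finally have c5: "\<alpha>1 \<cdot> (unsh_sh T Z \<cdot> \<Sigma>\<^sup>- h'') = \<boxminus> (\<alpha>2 \<cdot> (unsh_sh T X'' \<cdot> \<Sigma>\<^sup>- w''))" .
    \<comment> \<open>The diameter \<open>\<beta>1 \<cdot> \<alpha>2\<close> of the first hexagon
      serves as \<open>u''\<close>.\<close>
    show ?R
      by (rule exI[of _ X''], rule exI[of _ Y''], rule exI[of _ Z''],
          rule exI[of _ f'], rule exI[of _ f''], rule exI[of _ g'], rule exI[of _ g''],
          rule exI[of _ h'], rule exI[of _ h''], rule exI[of _ "\<beta>1 \<cdot> \<alpha>2"],
          rule exI[of _ v''], rule exI[of _ w''], rule exI[of _ A], rule exI[of _ vt],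
          rule exI[of _ wt], rule exI[of _ \<alpha>1], rule exI[of _ \<beta>1], rule exI[of _ \<alpha>2],
          rule exI[of _ \<beta>2], intro conjI)
        (use F G D tri1 tri2 tri3 tri4 o1 o2 eqs h c1 c2 c3 c4 c5 hD h1 h2 hom_ob in simp_all)
  next
    \<comment> \<open>Conversely, the hexagons contain every identity of both octahedra, with
      \<open>\<gamma>1 = \<Sigma> v \<cdot> g''\<close> and
      \<open>\<gamma>2 = \<Sigma> f' \<cdot> w'\<close>, and the diameter condition on
      \<open>h\<close> is the required factorization.\<close>
    assume ?R
    then show ?VG
      unfolding verdier_good_def octahedron_def by metis
  qed
qed

end
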